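(* Let $\mathcal{H}$ be a finite-dimensional real Hilbert space and $r\ge 2$. Let $K_1, K_2, \dots, K_{r-1}$ be closed subsets and $K_r$ be a closed affine subspace of $\mathcal{H}$ such that $\bigcap_{j=1}^r K_j \neq \varnothing$ and $P_{K_{r-1}}(K_r) \subseteq K_r$. Suppose that $K_1, \dots, K_{r-2}$, and $K_{r-1}\cap K_r$ are superregular at a point $\overline{x} \in \bigcap_{j=1}^r K_j$. Set $\overline{\mathbf{x}} := (\overline{x}, \overline{x}, \dots, \overline{x})\in \mathcal{H}^{r-1}$. Let $V,W$, the constraint-reduced MAP operator $S=P_WQ_V$ and the constraint-reduced DR operator $T=\operatorname{I}-P_W+Q_VR_W$ be as defined in the context. Then the following statements hold. (a) If $\{K_1, \dots, K_{r-2}, K_{r-1}\cap K_r\}$ is linearly regular around $\overline{x}$, then, whenever the starting point $\mathbf{x}_0$ is sufficiently close to $\overline{\mathbf{x}}$, the sequence $(\mathbf{x}_n)_{n\in \mathbb{N}}$ generated by $\mathbf{x}_{n+1} \in S(\mathbf{x}_n)$ converges $R$-linearly to a point $\mathbf{x}^\ast = (x^\ast, x^\ast, \dots, x^\ast)\in V\cap W$ with $x^\ast\in \bigcap_{j=1}^r K_j$. (b) If $\{K_1, \dots, K_{r-2}, K_{r-1}\cap K_r\}$ is strongly regular at $\overline{x}$, then, whenever the starting point $\mathbf{x}_0$ is sufficiently close to $\overline{\mathbf{x}}$, the sequence $(\mathbf{x}_n)_{n\in \mathbb{N}}$ generated by $\mathbf{x}_{n+1} \in T(\mathbf{x}_n)$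 converges $R$-linearly to a point $\mathbf{x}^\ast = (x^\ast, x^\ast, \dots, x^\ast)\in V\cap W$ with $x^\ast\in \bigcap_{j=1}^r K_j$.
   Context: $\mathcal{H}^{r-1}$ is the product Hilbert space with inner product $\langle\mathbf{x},\mathbf{y}\rangle=\sum_{j}\langle x_j,y_j\rangle$; $\mathbb{B}(x;\delta)$ is the closed ball. For a nonempty set $C$, $d_C(x)=\inf_{z\in C}\|x-z\|$ and the projector is the set-valued operator $P_C(x)=\{c\in C:\|x-c\|=d_C(x)\}$; for a set $K$, $P_C(K)=\bigcup_{x\in K}P_C(x)$; compositions of set-valued operators are $PP'(x)=P(P'(x))$. Define $$V := K_1\times \cdots \times K_{r-2} \times (K_{r-1}\cap K_r),\qquad W := \{(x_1,\dots,x_{r-1})\in\mathcal{H}^{r-1} : x_1=\cdots=x_{r-1}\},$$ $$Q_V(\mathbf{x}) := P_{K_1}(x_1)\times\cdots\times P_{K_{r-2}}(x_{r-2})\times P_{K_{r-1}}P_{K_r}(x_{r-1}),\qquad P_W(\mathbf{x}) := \Big(\tfrac{1}{r-1}\sum_{j=1}^{r-1}x_j,\dots,\tfrac{1}{r-1}\sum_{j=1}^{r-1}x_j\Big),$$ $R_W:=2P_W-\operatorname{I}$, $S:=P_WQ_V$, and $T(\mathbf{x}):=\mathbf{x}-P_W(\mathbf{x})+Q_V(R_W(\mathbf{x}))$ (both in general set-valued). Limiting normal cone: for a nonempty closed set $C$ and $x\in C$, $N_C(x)=\{\lim_{n\to\infty}\lambda_n(z_n-x_n)\,:\,\lambda_n\ge0,\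 x_n\to x,\ z_n\in P_C(x_n)\}$ up to the sign convention, the intended object being the Mordukhovich limiting normal cone $N_C(x)=\{\lim_{n\to\infty}\lambda_n(x_n-z_n)\,:\,\lambda_n\ge0,\ x_n\to x,\ z_n\in P_C(x_n)\}$, which is the one to be used here. A closed set $C$ is superregular at $x\in C$ if for any $\varepsilon>0$ there is $\delta>0$ such that $\langle u,y-z\rangle\le\varepsilon\|u\|\|y-z\|$ for all $y,z\in C\cap\mathbb{B}(x;\delta)$ and all $u\in N_C(z)$. A family $\{L_1,\dots,L_m\}$ of closed sets is linearly regular around $x$ if there exist $\kappa\ge0$, $\delta>0$ such that $d_{L_1\cap\dots\cap L_m}(z)\le\kappa\max\{d_{L_1}(z),\dots,d_{L_m}(z)\}$ for all $z\in\mathbb{B}(x;\delta)$. It is strongly regular at $x$ if $u_1+\dots+u_m=0$ with $u_j\in N_{L_j}(x)$ implies $u_1=\dots=u_m=0$. A sequence $(x_n)$ converges $R$-linearly to $x^\ast$ if there exist $\rho\in[0,1)$ and $\sigma>0$ with $\|x_n-x^\ast\|\le\sigma\rho^n$ for all $n\in\mathbb{N}$. *)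

theory Defs
  imports "HOL-Analysis.Analysis"
begin

definition projector :: "'a::metric_space set \<Rightarrow> 'a \<Rightarrow> 'a set" where
  "projector C x = {c \<in> C. dist x c = infdist x C}"

definition projector_image :: "'a::metric_space set \<Rightarrow> 'a set \<Rightarrow> 'a set" where
  "projector_image C A = (\<Union>x\<in>A. projector C x)"

text \<open>The Mordukhovich limiting normal cone: the directions point from the projections
  \<open>z n\<close> to the points \<open>y n\<close>.\<close>

definition limiting_normal_cone :: "'a::real_inner set \<Rightarrow> 'a \<Rightarrow> 'a set" where
  "limiting_normal_cone C x =
    {u. \<exists>(t :: nat \<Rightarrow> real) y z.
          (\<forall>n. t n \<ge> 0) \<and> y \<longlonglongrightarrow> x \<and> (\<forall>n. z n \<in> projector C (y n)) \<and>
          (\<lambda>n. t n *\<^sub>R (y n - z n)) \<longlonglongrightarrow> u}"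

definition superregular_at :: "'a::real_inner set \<Rightarrow> 'a \<Rightarrow> bool" where
  "superregular_at C x \<longleftrightarrow>
    (\<forall>\<epsilon>>0. \<exists>\<delta>>0. \<forall>y \<in> C \<inter> cball x \<delta>. \<forall>z \<in> C \<inter> cball x \<delta>. \<forall>u \<in> limiting_normal_cone C z.
        u \<bullet> (y - z) \<le> \<epsilon> * norm u * norm (y - z))"

text \<open>Both regularity notions concern a family indexed by a finite nonempty set \<open>I\<close>, not a set
  of sets: for strong regularity, repeated members count with their multiplicity.\<close>

definition linearly_regular_around :: "'i set \<Rightarrow> ('i \<Rightarrow> 'a::real_inner set) \<Rightarrow> 'a \<Rightarrow> bool" where
  "linearly_regular_around I L x \<longleftrightarrow>
    (\<exists>\<kappa>\<ge>0. \<exists>\<delta>>0. \<forall>z \<in> cball x \<delta>.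
        infdist z (\<Inter>j\<in>I. L j) \<le> \<kappa> * Max ((\<lambda>j. infdist z (L j)) ` I))"

definition strongly_regular_at :: "'i set \<Rightarrow> ('i \<Rightarrow> 'a::real_inner set) \<Rightarrow> 'a \<Rightarrow> bool" where
  "strongly_regular_at I L x \<longleftrightarrow>
    (\<forall>u. (\<forall>j\<in>I. u j \<in> limiting_normal_cone (L j) x) \<and> (\<Sum>j\<in>I. u j) = 0 \<longrightarrow>
         (\<forall>j\<in>I. u j = 0))"

definition R_linearly_converges :: "(nat \<Rightarrow> 'a::real_normed_vector) \<Rightarrow> 'a \<Rightarrow> bool" where
  "R_linearly_converges x l \<longleftrightarrow>
    (\<exists>\<rho> \<sigma>. 0 \<le> \<rho> \<and> \<rho> < 1 \<and> \<sigma> > 0 \<and> (\<forall>n. norm (x n - l) \<le> \<sigma> * \<rho> ^ n))"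

text \<open>The family \<open>K 1, \<dots>, K (r - 2), K (r - 1) \<inter> K r\<close>, indexed by \<open>{1..r - 1}\<close>.\<close>

definition reduced_family :: "nat \<Rightarrow> (nat \<Rightarrow> 'a set) \<Rightarrow> nat \<Rightarrow> 'a set" where
  "reduced_family r K j = (if j = r - 1 then K (r - 1) \<inter> K r else K j)"

text \<open>The product Hilbert space with \<open>r - 1\<close> factors is \<open>'a ^ 'n\<close>, whose inner product is the
  sum of the inner products of the components.  A numbering \<open>idx\<close> of the coordinates, intended to
  be a bijection from \<open>'n\<close> onto \<open>{1..r - 1}\<close>, says which coordinate is the \<open>j\<close>-th one; in
  particular \<open>CARD('n) = r - 1\<close>.\<close>

definition reduced_product ::
    "('n::finite \<Rightarrow> nat) \<Rightarrow> nat \<Rightarrow> (nat \<Rightarrow> 'a set) \<Rightarrow> ('a ^ 'n) set" where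
  "reduced_product idx r K = {x. \<forall>i. x $ i \<in> reduced_family r K (idx i)}"

definition diagonal :: "('a ^ 'n::finite) set" where
  "diagonal = {x. \<forall>i k. x $ i = x $ k}"

definition Q_V ::
    "('n::finite \<Rightarrow> nat) \<Rightarrow> nat \<Rightarrow> (nat \<Rightarrow> 'a::euclidean_space set) \<Rightarrow> 'a ^ 'n \<Rightarrow> ('a ^ 'n) set" where
  "Q_V idx r K x =
    {y. \<forall>i. y $ i \<in> (if idx i = r - 1
                     then projector_image (K (r - 1)) (projector (K r) (x $ i))
                     else projector (K (idx i)) (x $ i))}"

definition P_W :: "'a::euclidean_space ^ 'n::finite \<Rightarrow> 'a ^ 'n" where
  "P_W x = (\<chi> i. (1 / real CARD('n)) *\<^sub>R (\<Sum>j\<in>UNIV. x $ j))"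

definition R_W :: "'a::euclidean_space ^ 'n::finite \<Rightarrow> 'a ^ 'n" where
  "R_W x = 2 *\<^sub>R P_W x - x"

definition MAP_op ::
    "('n::finite \<Rightarrow> nat) \<Rightarrow> nat \<Rightarrow> (nat \<Rightarrow> 'a::euclidean_space set) \<Rightarrow> 'a ^ 'n \<Rightarrow> ('a ^ 'n) set" where
  "MAP_op idx r K x = P_W ` Q_V idx r K x"

definition DR_op ::
    "('n::finite \<Rightarrow> nat) \<Rightarrow> nat \<Rightarrow> (nat \<Rightarrow> 'a::euclidean_space set) \<Rightarrow> 'a ^ 'n \<Rightarrow> ('a ^ 'n) set" where
  "DR_op idx r K x = (\<lambda>q. x - P_W x + q) ` Q_V idx r K (R_W x)"

end

theory Submission
  imports Defs
begin

text \<open>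
  Projecting onto the affine set \<open>K r\<close> and then onto
  \<open>K (r - 1)\<close> yields a nearest point of \<open>K (r - 1) \<inter> K r\<close>, because all nearest points of
  \<open>K (r - 1)\<close> to points of \<open>K r\<close> lie in \<open>K r\<close> again and Pythagoras' theorem compares distances from
  a point with distances from its projection
  (\<open>projector_affine_inter_subset\<close>). Hence \<open>Q_V\<close> selects from the genuine projector onto the
  product set \<open>V\<close>, and the two iterations are alternating projections and Douglas--Rachford
  iterations for \<open>V\<close> and the diagonal \<open>W\<close>, whose orthogonal projector \<open>P\<close> is linear.

  Let \<open>C = V \<inter> W\<close>. In both cases one step contracts the distance to \<open>C\<close> by a fixed factor below one
  and moves the iterate by at most a multiple of that distance. The movements are then dominated by
  a geometric series, so an iterate that starts close enough to the base point never leaves the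
  neighbourhood where the estimates hold, and it converges R-linearly to a point of \<open>C\<close>
  (\<open>contracting_infdist_R_linear_convergence\<close>).

  For alternating projections let \<open>a \<in> W\<close>, let \<open>b\<close> be a nearest point of \<open>V\<close> and \<open>c\<close> a nearest point
  of \<open>C\<close>. Expanding squares,
  \<open>\<parallel>P b - c\<parallel>\<^sup>2 \<le> \<parallel>b - c\<parallel>\<^sup>2 = \<parallel>a - c\<parallel>\<^sup>2 - \<parallel>a - b\<parallel>\<^sup>2 + 2 (a - b) \<bullet> (c - b)\<close>. Superregularity makes the
  inner product at most \<open>\<epsilon> \<parallel>a - c\<parallel>\<^sup>2\<close>, and linear regularity bounds \<open>\<parallel>a - b\<parallel>\<close> from below by a
  multiple of \<open>\<parallel>a - c\<parallel>\<close>.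

  For the Douglas--Rachford step \<open>x \<mapsto> x - P x + b\<close> the same formula holds exactly, with \<open>x - c\<close> in
  place of \<open>a - c\<close>, with \<open>a = P x\<close>, and with the proximal normal \<open>u = (2 a - x) - b\<close> in the inner
  product. Now \<open>\<parallel>a - b\<parallel>\<close> must also control the component \<open>x - P x\<close> orthogonal to \<open>W\<close>. Strong regularity
  provides this: by compactness it gives \<open>c0 \<parallel>u\<parallel> \<le> \<parallel>P u\<parallel>\<close> for all proximal normals \<open>u\<close> of \<open>V\<close>
  near the base point (\<open>strongly_regular_imp_transversal\<close>), and \<open>P u = P (a - b)\<close>. The remaining
  component in \<open>W\<close> is controlled by linear regularity, which follows from the same inequality,
  since it makes alternating projections contract the distance to \<open>V\<close>
  (\<open>transversal_imp_subtransversal\<close>).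
\<close>
section \<open>Projectors\<close>

lemma projector_iff: "c \<in> projector C x \<longleftrightarrow> c \<in> C \<and> (\<forall>v\<in>C. dist x c \<le> dist x v)"
proof
  assume "c \<in> projector C x"
  then show "c \<in> C \<and> (\<forall>v\<in>C. dist x c \<le> dist x v)"
    by (auto simp: projector_def infdist_le)
next
  assume c: "c \<in> C \<and> (\<forall>v\<in>C. dist x c \<le> dist x v)"
  then have "dist x c \<le> infdist x C"
    by (subst infdist_notempty) (auto intro!: cINF_greatest)
  with c show "c \<in> projector C x"
    using infdist_le[of c C x] by (simp add: projector_def)
qed

lemma projector_nonempty:
  fixes C :: "'a::heine_borel set"
  assumes "closed C" "C \<noteq> {}"
  obtains c where "c \<in> projector C x"
proof -
  obtain c where "c \<in> C" "infdist x C = dist x c" using infdist_attains_inf[OF assms] .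
  then have "c \<in> projector C x" by (simp add: projector_def)
  then show ?thesis by (rule that)
qed

lemma projector_dist_le:
  assumes "b \<in> projector C z" "w \<in> C"
  shows "dist b w \<le> 2 * dist z w"
proof -
  have "dist z b \<le> dist z w" using assms by (auto simp: projector_iff)
  then show ?thesis using dist_triangle[of b w z] by (simp add: dist_commute)
qed

text \<open>Within the affine set \<open>A\<close>, the squared distances to \<open>x\<close> and to its projection \<open>p\<close> differ by a
  constant, so they have the same minimizers on \<open>B \<inter> A\<close>. A point of \<open>B\<close> nearest to \<open>p\<close> lies in
  \<open>A\<close> by assumption and is therefore such a minimizer.\<close>
lemma projector_affine_inter_subset:
  fixes A B :: "'a::euclidean_space set"
  assumes "closed A" "affine A" and inv: "projector_image B A \<subseteq> A"
  shows "projector_image B (projector A x) \<subseteq> projector (B \<inter> A) x"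
proof
  fix z assume "z \<in> projector_image B (projector A x)"
  then obtain p where p: "p \<in> projector A x" and z: "z \<in> projector B p"
    by (auto simp: projector_image_def)
  from p have pA: "p \<in> A" and pmin: "\<forall>v\<in>A. dist x p \<le> dist x v" by (auto simp: projector_iff)
  have zA: "z \<in> A" using inv z pA by (auto simp: projector_image_def)
  have zB: "z \<in> B" and zmin: "\<forall>v\<in>B. dist p z \<le> dist p v" using z by (auto simp: projector_iff)
  have le: "(x - p) \<bullet> (c - p) \<le> 0" if "c \<in> A" for c
    using any_closest_point_dot[of A p c x] assms pA pmin that affine_imp_convex by blast
  have pyth: "(dist x c)\<^sup>2 = (dist x p)\<^sup>2 + (dist p c)\<^sup>2" if c: "c \<in> A" for c
  proof -
    \<comment> \<open>The reflected point turns the variational inequality at the projection into an equality.\<close>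
    have "2 *\<^sub>R p - c \<in> A"
      using mem_affine[OF \<open>affine A\<close> pA c, of 2 "-1"] by simp
    moreover have "2 *\<^sub>R p - c - p = - (c - p)" by (simp add: scaleR_2)
    ultimately have "0 \<le> (x - p) \<bullet> (c - p)"
      using le[of "2 *\<^sub>R p - c"] by (metis inner_minus_right neg_le_0_iff_le)
    then have "(x - p) \<bullet> (c - p) = 0" using le[OF c] by simp
    then show ?thesis
      unfolding dist_norm power2_norm_eq_inner by (simp add: algebra_simps inner_commute)
  qed
  have "dist x z \<le> dist x v" if v: "v \<in> B \<inter> A" for v
  proof -
    have "(dist p z)\<^sup>2 \<le> (dist p v)\<^sup>2" using zmin v by (simp add: power_mono)
    then have "(dist x z)\<^sup>2 \<le> (dist x v)\<^sup>2" using pyth[of z] pyth[of v] v zA by auto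
    then show ?thesis by (rule power2_le_imp_le) simp
  qed
  then show "z \<in> projector (B \<inter> A) x" using zA zB by (auto simp: projector_iff)
qed

lemma projector_segment:
  fixes z :: "'a::real_normed_vector"
  assumes b: "b \<in> projector C z" and "0 \<le> t" "t \<le> 1"
  shows "b \<in> projector C (b + t *\<^sub>R (z - b))"
proof -
  have "dist (b + t *\<^sub>R (z - b)) b \<le> dist (b + t *\<^sub>R (z - b)) v" if "v \<in> C" for v
  proof -
    have 1: "dist (b + t *\<^sub>R (z - b)) b = t * dist z b" using assms by (simp add: dist_norm)
    have "z - (b + t *\<^sub>R (z - b)) = (1 - t) *\<^sub>R (z - b)" by (simp add: algebra_simps)
    then have 2: "dist z (b + t *\<^sub>R (z - b)) = (1 - t) * dist z b" using assms by (simp add: dist_norm)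
    have "dist z b \<le> dist z v" using b that by (auto simp: projector_iff)
    also have "\<dots> \<le> dist z (b + t *\<^sub>R (z - b)) + dist (b + t *\<^sub>R (z - b)) v" by (rule dist_triangle)
    finally show ?thesis using 1 2 by (simp add: algebra_simps)
  qed
  then show ?thesis using b by (auto simp: projector_iff)
qed

text \<open>The sequences in the definition of the limiting normal cone must have base points converging
  to \<open>b\<close> itself. The points \<open>b + (z - b) / (n + 1)\<close> serve, as \<open>b\<close> remains a nearest point all along
  the segment from \<open>b\<close> to \<open>z\<close>.\<close>
lemma proximal_normal_in_limiting_normal_cone:
  assumes "b \<in> projector C z"
  shows "z - b \<in> limiting_normal_cone C b"
proof -
  define y where "y n = b + inverse (real (Suc n)) *\<^sub>R (z - b)" for n
  have "y \<longlonglongrightarrow> b + 0 *\<^sub>R (z - b)"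
    unfolding y_def by (intro tendsto_intros LIMSEQ_inverse_real_of_nat)
  moreover have "\<forall>n. b \<in> projector C (y n)"
    unfolding y_def by (intro allI projector_segment assms) (auto simp: field_simps)
  moreover have "(\<lambda>n. real (Suc n) *\<^sub>R (y n - b)) \<longlonglongrightarrow> z - b"
    by (simp add: y_def del: of_nat_Suc)
  ultimately show ?thesis unfolding limiting_normal_cone_def
    by (intro CollectI exI[of _ "\<lambda>n. real (Suc n)"] exI[of _ y] exI[of _ "\<lambda>_. b"]) auto
qed

section \<open>Geometric convergence\<close>

text \<open>The quantity \<open>g n\<close> measures how far \<open>x n\<close> is from a solution. The estimates on a step are only
  available near \<open>w\<close>; the hypothesis on the start reserves room for the whole geometric series of
  movements, so that induction keeps the sequence where they apply.\<close>
lemma R_linear_convergence_of_contracting_gap: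
  fixes x :: "nat \<Rightarrow> 'a::banach" and g :: "nat \<Rightarrow> real"
  assumes "0 \<le> \<rho>" "\<rho> < 1" "0 \<le> M" and g: "\<And>n. 0 \<le> g n"
    and step: "\<And>n. dist (x n) w \<le> \<delta> \<Longrightarrow> dist (x (Suc n)) (x n) \<le> M * g n \<and> g (Suc n) \<le> \<rho> * g n"
    and start: "dist (x 0) w + M * g 0 / (1 - \<rho>) \<le> \<delta>"
  obtains l where "R_linearly_converges x l" "g \<longlonglongrightarrow> 0"
    "dist (x 0) l \<le> M * g 0 / (1 - \<rho>)"
proof -
  define B where "B = M * g 0 / (1 - \<rho>)"
  have B: "0 \<le> B" and BM: "B * (1 - \<rho>) = M * g 0" using assms by (auto simp: B_def)
  have inv: "dist (x n) w \<le> \<delta> \<and> g n \<le> g 0 * \<rho> ^ n \<and> dist (x 0) (x n) \<le> B * (1 - \<rho> ^ n)" for n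
  proof (induction n)
    case 0
    then show ?case using start B by (simp add: B_def[symmetric])
  next
    case (Suc n)
    have s: "dist (x (Suc n)) (x n) \<le> M * g n" "g (Suc n) \<le> \<rho> * g n" using step[of n] Suc by auto
    have g': "g (Suc n) \<le> g 0 * \<rho> ^ Suc n"
    proof -
      have "\<rho> * g n \<le> \<rho> * (g 0 * \<rho> ^ n)" using Suc \<open>0 \<le> \<rho>\<close> by (intro mult_left_mono) auto
      then show ?thesis using s by (simp add: algebra_simps)
    qed
    have "M * g n \<le> M * (g 0 * \<rho> ^ n)" using Suc \<open>0 \<le> M\<close> by (intro mult_left_mono) auto
    then have "dist (x (Suc n)) (x n) \<le> B * (1 - \<rho>) * \<rho> ^ n" using s BM by simp
    then have d: "dist (x 0) (x (Suc n)) \<le> B * (1 - \<rho> ^ Suc n)"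
      using Suc dist_triangle[of "x 0" "x (Suc n)" "x n"] by (simp add: dist_commute algebra_simps)
    have "B * (1 - \<rho> ^ Suc n) \<le> B" using B \<open>0 \<le> \<rho>\<close> by (simp add: mult_left_le)
    then have "dist (x (Suc n)) w \<le> \<delta>"
      using d start dist_triangle[of "x (Suc n)" w "x 0"] by (simp add: B_def[symmetric] dist_commute)
    with g' d show ?case by simp
  qed
  have tail: "dist (x n) (x (n + k)) \<le> B * \<rho> ^ n * (1 - \<rho> ^ k)" for n k
  proof (induction k)
    case (Suc k)
    have "M * g (n + k) \<le> M * (g 0 * \<rho> ^ (n + k))" using inv[of "n+k"] \<open>0 \<le> M\<close> by (intro mult_left_mono) auto
    also have "\<dots> = B * (1 - \<rho>) * \<rho> ^ (n + k)" using BM by simp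
    finally have "dist (x (Suc (n + k))) (x (n + k)) \<le> B * (1 - \<rho>) * \<rho> ^ (n + k)"
      using step[of "n+k"] inv[of "n+k"] by auto
    then show ?case using Suc dist_triangle[of "x n" "x (Suc (n + k))" "x (n + k)"]
      by (simp add: dist_commute algebra_simps power_add)
  qed simp
  have tail': "dist (x n) (x (n + k)) \<le> B * \<rho> ^ n" for n k
  proof -
    have "B * \<rho> ^ n * (1 - \<rho> ^ k) \<le> B * \<rho> ^ n"
      using B \<open>0 \<le> \<rho>\<close> by (intro mult_left_le) auto
    then show ?thesis using tail[of n k] by linarith
  qed
  have lim0: "(\<lambda>n. c * \<rho> ^ n) \<longlonglongrightarrow> 0" for c
    using tendsto_mult_right_zero[OF LIMSEQ_power_zero[of \<rho>]] assms by auto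
  have "Cauchy x"
  proof (rule metric_CauchyI)
    fix e :: real assume "0 < e"
    then obtain N where N: "B * \<rho> ^ N < e / 2"
      using order_tendstoD(2)[OF lim0[of B], of "e / 2"] by (auto simp: eventually_sequentially)
    have "dist (x m) (x n) < e" if "m \<ge> N" "n \<ge> N" for m n
      using tail'[of N "m - N"] tail'[of N "n - N"] that N dist_triangle[of "x m" "x n" "x N"]
      by (simp add: dist_commute)
    then show "\<exists>N. \<forall>m\<ge>N. \<forall>n\<ge>N. dist (x m) (x n) < e" by blast
  qed
  then obtain l where l: "x \<longlonglongrightarrow> l" using Cauchy_convergent convergent_def by blast
  have bound: "dist (x n) l \<le> B * \<rho> ^ n" for n
  proof (rule LIMSEQ_le_const2)
    show "(\<lambda>k. dist (x n) (x (k + n))) \<longlonglongrightarrow> dist (x n) l"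
      by (intro tendsto_intros LIMSEQ_ignore_initial_segment l)
    show "\<exists>N. \<forall>k\<ge>N. dist (x n) (x (k + n)) \<le> B * \<rho> ^ n"
      using tail'[of n] by (auto simp: add.commute)
  qed
  have "norm (x n - l) \<le> (B + 1) * \<rho> ^ n" for n
    using bound[of n] zero_le_power[OF \<open>0 \<le> \<rho>\<close>, of n] by (simp add: dist_norm algebra_simps)
  then have "R_linearly_converges x l"
    unfolding R_linearly_converges_def using assms B by (intro exI[of _ \<rho>] exI[of _ "B + 1"]) auto
  moreover have "g \<longlonglongrightarrow> 0"
    by (rule tendsto_sandwich[OF _ _ tendsto_const lim0[of "g 0"]]) (use g inv in auto)
  ultimately show ?thesis using that[of l] bound[of 0] by (simp add: B_def)
qed

lemma R_linearly_converges_imp_LIMSEQ: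
  assumes "R_linearly_converges x l"
  shows "x \<longlonglongrightarrow> l"
proof -
  obtain \<rho> \<sigma> where r: "0 \<le> \<rho>" "\<rho> < 1" "\<And>n. norm (x n - l) \<le> \<sigma> * \<rho> ^ n"
    using assms by (auto simp: R_linearly_converges_def)
  have "(\<lambda>n. \<sigma> * \<rho> ^ n) \<longlonglongrightarrow> 0"
    using tendsto_mult_right_zero[OF LIMSEQ_power_zero[of \<rho>]] r by auto
  then have "(\<lambda>n. x n - l) \<longlonglongrightarrow> 0"
    by (rule Lim_null_comparison[rotated]) (use r in auto)
  then show ?thesis by (simp add: LIM_zero_iff)
qed

text \<open>Prepending a term costs a factor \<open>1 / \<rho>\<close> in the constant, which is why the rate is first raised
  to at least \<open>1 / 2\<close>: the rate \<open>0\<close> would not survive.\<close>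
lemma R_linearly_converges_Suc:
  assumes "R_linearly_converges (\<lambda>n. x (Suc n)) l"
  shows "R_linearly_converges x l"
proof -
  obtain \<rho> \<sigma> where r: "0 \<le> \<rho>" "\<rho> < 1" "0 < \<sigma>" "\<And>n. norm (x (Suc n) - l) \<le> \<sigma> * \<rho> ^ n"
    using assms by (auto simp: R_linearly_converges_def)
  define q where "q = max \<rho> (1/2)"
  have q: "0 < q" "q < 1" "\<rho> \<le> q" using r by (auto simp: q_def)
  have "norm (x n - l) \<le> (norm (x 0 - l) + \<sigma> / q) * q ^ n" for n
  proof (cases n)
    case 0
    then show ?thesis using q r by simp
  next
    case (Suc m)
    have "norm (x n - l) \<le> \<sigma> * \<rho> ^ m" using r Suc by simp
    also have "\<dots> \<le> \<sigma> * q ^ m" using r q by (intro mult_left_mono power_mono) auto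
    also have "\<dots> = (\<sigma> / q) * q ^ n" using q Suc by simp
    also have "\<dots> \<le> (norm (x 0 - l) + \<sigma> / q) * q ^ n" using q by (intro mult_right_mono) auto
    finally show ?thesis .
  qed
  then show ?thesis unfolding R_linearly_converges_def using q r
    by (intro exI[of _ q] exI[of _ "norm (x 0 - l) + \<sigma> / q"]) (auto intro: add_nonneg_pos)
qed

text \<open>The gap is taken to be the distance to \<open>C\<close>. At the start it is at most the distance to
  \<open>w \<in> C\<close>, so closeness to \<open>w\<close> alone leaves enough room.\<close>
lemma contracting_infdist_R_linear_convergence:
  fixes x :: "nat \<Rightarrow> 'a::euclidean_space"
  assumes "closed C" "w \<in> C" "0 \<le> \<rho>" "\<rho> < 1" "0 \<le> M"
    and step: "\<And>n. dist (x n) w \<le> \<delta> \<Longrightarrow>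
      dist (x (Suc n)) (x n) \<le> M * infdist (x n) C \<and> infdist (x (Suc n)) C \<le> \<rho> * infdist (x n) C"
    and start: "dist (x 0) w \<le> \<delta> / (1 + M / (1 - \<rho>))"
  obtains l where "l \<in> C" "R_linearly_converges x l"
    "dist (x 0) l \<le> M / (1 - \<rho>) * infdist (x 0) C"
proof -
  have Q: "0 \<le> M / (1 - \<rho>)" using assms by simp
  have "M / (1 - \<rho>) * infdist (x 0) C \<le> M / (1 - \<rho>) * dist (x 0) w"
    using Q \<open>w \<in> C\<close> by (intro mult_left_mono infdist_le) auto
  moreover have "dist (x 0) w * (1 + M / (1 - \<rho>)) \<le> \<delta>"
    using start Q by (simp add: pos_le_divide_eq)
  ultimately have "dist (x 0) w + M * infdist (x 0) C / (1 - \<rho>) \<le> \<delta>"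
    by (simp add: algebra_simps)
  then obtain l where l: "R_linearly_converges x l" "(\<lambda>n. infdist (x n) C) \<longlonglongrightarrow> 0"
    "dist (x 0) l \<le> M * infdist (x 0) C / (1 - \<rho>)"
    using R_linear_convergence_of_contracting_gap[of \<rho> M "\<lambda>n. infdist (x n) C" x w \<delta>] assms
      infdist_nonneg by metis
  have "(\<lambda>n. infdist (x n) C) \<longlonglongrightarrow> infdist l C"
    by (intro tendsto_infdist R_linearly_converges_imp_LIMSEQ l)
  then have "infdist l C = 0" using l LIMSEQ_unique by blast
  then have "l \<in> C" using in_closed_iff_infdist_zero[of C l] assms by auto
  then show ?thesis using that l by simp
qed

lemma contraction_factor:
  fixes \<Lambda> :: real
  assumes "1 \<le> \<Lambda>"
  obtains \<rho> where "0 \<le> \<rho>" "\<rho> < 1" "\<rho>\<^sup>2 = 1 - 1 / (2 * \<Lambda>)"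
proof -
  have "0 < 1 / (2 * \<Lambda>)" "1 / (2 * \<Lambda>) \<le> 1" using assms by (auto simp: divide_le_eq)
  then show ?thesis by (intro that[of "sqrt (1 - 1 / (2 * \<Lambda>))"]) auto
qed

section \<open>Projection methods between a subspace and a closed set\<close>

locale orthogonal_projector =
  fixes P :: "'a::euclidean_space \<Rightarrow> 'a"
  assumes linear: "linear P"
    and idem: "P (P x) = P x"
    and selfadjoint: "P x \<bullet> y = x \<bullet> P y"
begin

lemma diff: "P (x - y) = P x - P y" by (rule linear_diff[OF linear])

lemma orthogonal: "P x \<bullet> (y - P y) = 0"
  by (simp add: inner_diff_right idem selfadjoint)

lemma pythagoras: "(norm x)\<^sup>2 = (norm (P x))\<^sup>2 + (norm (x - P x))\<^sup>2"
  using orthogonal[of x x] unfolding power2_norm_eq_inner by (simp add: algebra_simps inner_commute)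

lemma norm_le: "norm (P x) \<le> norm x"
  by (rule power2_le_imp_le) (use pythagoras[of x] in auto)

lemma dist_le: "P w = w \<Longrightarrow> dist (P x) w \<le> dist x w"
  using norm_le[of "x - w"] by (simp add: diff dist_norm)

text \<open>The reflection in a subspace is an isometry that fixes the points of the subspace.\<close>
lemma reflection_dist:
  assumes "P w = w"
  shows "dist (2 *\<^sub>R P x - x) w = dist x w"
proof -
  have "P (x - w) \<bullet> (x - P x) = 0" by (rule orthogonal)
  then have "(P x - w) \<bullet> (x - P x) = 0" using assms by (simp add: diff)
  then have "(dist (2 *\<^sub>R P x - x) w)\<^sup>2 = (dist x w)\<^sup>2"
    unfolding dist_norm power2_norm_eq_inner by (simp add: algebra_simps inner_commute)
  then show ?thesis by (simp add: power2_eq_iff_nonneg)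
qed

lemma closed_fixed_points: "closed {x. P x = x}"
  by (intro closed_Collect_eq linear_continuous_on continuous_on_id)
    (use linear linear_conv_bounded_linear in auto)

text \<open>No proximal normal of \<open>V\<close> near \<open>w\<close> is nearly orthogonal to the subspace of fixed points of \<open>P\<close>.
  For closed \<open>V\<close> in finite dimension this is the quantitative form of the condition that the limiting
  normal cone of \<open>V\<close> at \<open>w\<close> meets the orthogonal complement of that subspace only in \<open>0\<close>.\<close>
definition transversal_at :: "'a set \<Rightarrow> 'a \<Rightarrow> bool" where
  "transversal_at V w \<longleftrightarrow> (\<exists>c>0. \<exists>\<delta>>0. \<forall>z\<in>cball w \<delta>. \<forall>b\<in>projector V z.
     c * norm (z - b) \<le> norm (P (z - b)))"

text \<open>Linear regularity of \<open>V\<close> and the subspace, tested at the points of the subspace only.\<close>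
definition subtransversal_at :: "'a set \<Rightarrow> 'a \<Rightarrow> bool" where
  "subtransversal_at V w \<longleftrightarrow> (\<exists>\<kappa>>0. \<exists>\<delta>>0. \<forall>a\<in>cball w \<delta>. P a = a \<longrightarrow>
     (\<forall>b\<in>V. infdist a (V \<inter> {x. P x = x}) \<le> \<kappa> * dist a b))"

lemma subtransversal_atE:
  assumes "subtransversal_at V w"
  obtains \<kappa> \<delta> where "\<kappa> \<ge> 1" "\<delta> > 0"
    "\<And>a b. dist a w \<le> \<delta> \<Longrightarrow> P a = a \<Longrightarrow> b \<in> V \<Longrightarrow>
      infdist a (V \<inter> {x. P x = x}) \<le> \<kappa> * dist a b"
proof -
  obtain \<kappa> \<delta> where k: "\<kappa> > 0" "\<delta> > 0" "\<forall>a\<in>cball w \<delta>. P a = a \<longrightarrow>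
     (\<forall>b\<in>V. infdist a (V \<inter> {x. P x = x}) \<le> \<kappa> * dist a b)"
    using assms unfolding subtransversal_at_def by blast
  have "infdist a (V \<inter> {x. P x = x}) \<le> max 1 \<kappa> * dist a b"
    if "dist a w \<le> \<delta>" "P a = a" "b \<in> V" for a b
  proof -
    have "infdist a (V \<inter> {x. P x = x}) \<le> \<kappa> * dist a b" using k that by (auto simp: dist_commute)
    also have "\<dots> \<le> max 1 \<kappa> * dist a b" by (intro mult_right_mono) auto
    finally show ?thesis .
  qed
  then show ?thesis using that[of "max 1 \<kappa>" \<delta>] k by auto
qed

text \<open>For \<open>a\<close> in the subspace, a nearest point \<open>b \<in> V\<close> and \<open>u = a - b\<close>, the next point \<open>P b = a - P u\<close>
  has distance at most \<open>\<parallel>u - P u\<parallel>\<close> to \<open>V\<close>, and transversality makes this at most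
  \<open>sqrt (1 - d\<^sup>2) \<parallel>u\<parallel>\<close>. So alternating projections contract the distance to \<open>V\<close> and end in a common
  point whose distance to \<open>a\<close> is at most a constant times the distance from \<open>a\<close> to \<open>V\<close>.\<close>
lemma transversal_imp_subtransversal:
  assumes "transversal_at V w" "closed V" "w \<in> V" "P w = w"
  shows "subtransversal_at V w"
proof -
  obtain c \<delta> where c: "c > 0" "\<delta> > 0"
    and tr: "\<And>z b. dist z w \<le> \<delta> \<Longrightarrow> b \<in> projector V z \<Longrightarrow> c * norm (z - b) \<le> norm (P (z - b))"
    using assms(1) unfolding transversal_at_def by (auto simp: dist_commute)
  \<comment> \<open>Decreasing the constant keeps the radicand in the contraction factor positive.\<close>
  define d where "d = min c (1/2)"
  have d: "0 < d" "d < 1" "d \<le> c" using c by (auto simp: d_def)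
  define \<rho> where "\<rho> = sqrt (1 - d\<^sup>2)"
  have d2: "0 < d\<^sup>2" "d\<^sup>2 < 1" using d by (auto simp: abs_square_less_1)
  have \<rho>: "0 \<le> \<rho>" "\<rho> < 1" using d2 by (auto simp: \<rho>_def)
  define \<kappa> where "\<kappa> = 1 / (1 - \<rho>)"
  have \<kappa>: "\<kappa> > 0" using \<rho> by (simp add: \<kappa>_def)
  define \<eta> where "\<eta> = \<delta> / (1 + \<kappa>)"
  have \<eta>: "\<eta> > 0" using c \<kappa> by (simp add: \<eta>_def)
  have "infdist a (V \<inter> {x. P x = x}) \<le> \<kappa> * dist a b"
    if a: "dist a w \<le> \<eta>" "P a = a" and b: "b \<in> V" for a b
  proof -
    define pv where "pv z = (SOME y. y \<in> projector V z)" for z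
    have pv: "pv z \<in> projector V z" for z
    proof -
      obtain y where "y \<in> projector V z" using projector_nonempty[OF \<open>closed V\<close>] \<open>w \<in> V\<close> by blast
      then show ?thesis unfolding pv_def by (rule someI)
    qed
    define x where "x n = ((\<lambda>z. P (pv z)) ^^ n) a" for n
    have x0: "x 0 = a" and xS: "x (Suc n) = P (pv (x n))" for n by (auto simp: x_def)
    have Px: "P (x n) = x n" for n using a by (cases n) (auto simp: x0 xS idem)
    have step: "dist (x (Suc n)) (x n) \<le> 1 * infdist (x n) V \<and>
        infdist (x (Suc n)) V \<le> \<rho> * infdist (x n) V" if n: "dist (x n) w \<le> \<delta>" for n
    proof -
      let ?u = "x n - pv (x n)"
      have u: "norm ?u = infdist (x n) V" using pv[of "x n"] by (simp add: projector_def dist_norm)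
      have e: "x n - x (Suc n) = P ?u" by (simp add: xS diff Px)
      have 1: "dist (x (Suc n)) (x n) \<le> norm ?u"
        using norm_le[of ?u] e by (metis dist_norm dist_commute)
      have "d * norm ?u \<le> c * norm ?u" using d by (intro mult_right_mono) auto
      also have "\<dots> \<le> norm (P ?u)" by (rule tr[OF n pv])
      finally have "(d * norm ?u)\<^sup>2 \<le> (norm (P ?u))\<^sup>2" using d by (intro power_mono) auto
      then have "(norm (?u - P ?u))\<^sup>2 \<le> (1 - d\<^sup>2) * (norm ?u)\<^sup>2"
        using pythagoras[of ?u] by (simp add: algebra_simps power_mult_distrib)
      also have "\<dots> = (\<rho> * norm ?u)\<^sup>2" using d2 by (simp add: \<rho>_def power_mult_distrib)
      finally have "norm (?u - P ?u) \<le> \<rho> * norm ?u"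
        by (rule power2_le_imp_le) (use \<rho> in auto)
      moreover have "?u - P ?u = x (Suc n) - pv (x n)" using e by (simp add: algebra_simps)
      moreover have "infdist (x (Suc n)) V \<le> dist (x (Suc n)) (pv (x n))"
        using pv[of "x n"] by (intro infdist_le) (auto simp: projector_def)
      ultimately show ?thesis using 1 u by (simp add: dist_norm)
    qed
    have st: "dist (x 0) w \<le> \<delta> / (1 + 1 / (1 - \<rho>))" using a by (simp add: x0 \<eta>_def \<kappa>_def)
    obtain l where l: "l \<in> V" "R_linearly_converges x l" "dist (x 0) l \<le> 1 / (1 - \<rho>) * infdist (x 0) V"
      using contracting_infdist_R_linear_convergence[OF \<open>closed V\<close> \<open>w \<in> V\<close> \<rho> _ step st] by auto
    have "P l = l"
      using closed_sequentially[OF closed_fixed_points, of x l] Px R_linearly_converges_imp_LIMSEQ[OF l(2)]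
      by auto
    then have "infdist a (V \<inter> {x. P x = x}) \<le> dist a l" using l by (intro infdist_le) auto
    also have "\<dots> \<le> \<kappa> * infdist a V" using l by (simp add: x0 \<kappa>_def)
    also have "\<dots> \<le> \<kappa> * dist a b" using \<kappa> b by (intro mult_left_mono infdist_le) auto
    finally show ?thesis .
  qed
  then show ?thesis unfolding subtransversal_at_def
    by (intro exI[of _ \<kappa>] exI[of _ \<eta>] conjI ballI impI \<kappa> \<eta>) (simp add: dist_commute)
qed

end

text \<open>The part of superregularity that projection algorithms see: its inequality for proximal
  normals, with the neighbourhood imposed on the projected point instead of its projection. In this
  form it passes to products component by component.\<close>
definition proximally_superregular_at :: "'a::euclidean_space set \<Rightarrow> 'a \<Rightarrow> bool" where
  "proximally_superregular_at V w \<longleftrightarrow> (\<forall>\<epsilon>>0. \<exists>\<delta>>0. \<forall>z\<in>cball w \<delta>. \<forall>b\<in>projector V z.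
     \<forall>c\<in>V \<inter> cball w \<delta>. (z - b) \<bullet> (c - b) \<le> \<epsilon> * norm (z - b) * norm (c - b))"

text \<open>A nearest point \<open>b\<close> of \<open>z\<close> satisfies \<open>\<parallel>z - b\<parallel> \<le> \<parallel>z - c\<parallel>\<close> and \<open>\<parallel>c - b\<parallel> \<le> 2 \<parallel>z - c\<parallel>\<close>, so the
  superregularity error is a small multiple of a squared distance.\<close>
lemma proximally_superregular_bound:
  assumes "proximally_superregular_at V w" "\<epsilon> > 0"
  obtains \<delta> where "\<delta> > 0" "\<And>z b c. dist z w \<le> \<delta> \<Longrightarrow> b \<in> projector V z \<Longrightarrow> c \<in> V \<Longrightarrow>
    dist c w \<le> \<delta> \<Longrightarrow> (z - b) \<bullet> (c - b) \<le> \<epsilon> * (dist z c)\<^sup>2"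
proof -
  obtain \<delta> where d: "\<delta> > 0" "\<forall>z\<in>cball w \<delta>. \<forall>b\<in>projector V z.
     \<forall>c\<in>V \<inter> cball w \<delta>. (z - b) \<bullet> (c - b) \<le> (\<epsilon>/2) * norm (z - b) * norm (c - b)"
    using assms unfolding proximally_superregular_at_def by (meson half_gt_zero)
  have "(z - b) \<bullet> (c - b) \<le> \<epsilon> * (dist z c)\<^sup>2"
    if h: "dist z w \<le> \<delta>" "b \<in> projector V z" "c \<in> V" "dist c w \<le> \<delta>" for z b c
  proof -
    have 1: "norm (z - b) \<le> dist z c" using h by (auto simp: projector_iff dist_norm)
    have 2: "norm (c - b) \<le> 2 * dist z c"
      using projector_dist_le[OF h(2,3)] by (simp add: dist_norm norm_minus_commute)
    have "(z - b) \<bullet> (c - b) \<le> (\<epsilon>/2) * norm (z - b) * norm (c - b)"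
      using d h by (auto simp: dist_commute)
    also have "\<dots> \<le> (\<epsilon>/2) * dist z c * (2 * dist z c)"
      using assms 1 2 by (intro mult_mono) auto
    finally show ?thesis by (simp add: power2_eq_square)
  qed
  then show ?thesis using that d by blast
qed

context orthogonal_projector
begin

text \<open>With \<open>\<epsilon> = 1 / (4 \<kappa>\<^sup>2)\<close> the error term consumes half of the gain \<open>\<parallel>a - c\<parallel>\<^sup>2 / \<kappa>\<^sup>2\<close> that
  subtransversality guarantees, which leaves the squared contraction factor \<open>1 - 1 / (2 \<kappa>\<^sup>2)\<close>. The
  estimates concern points of the subspace, so they are applied from the second iterate on.\<close>
lemma alternating_projections_converge:
  assumes sr: "proximally_superregular_at V w" and st: "subtransversal_at V w"
    and V: "closed V" "w \<in> V" "P w = w"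
  obtains \<delta> where "\<delta> > 0" "\<And>x. dist (x 0) w \<le> \<delta> \<Longrightarrow> (\<And>n. x (Suc n) \<in> P ` projector V (x n)) \<Longrightarrow>
    \<exists>l \<in> V \<inter> {x. P x = x}. R_linearly_converges x l"
proof -
  define C where "C = V \<inter> {x. P x = x}"
  have C: "closed C" "w \<in> C" using V closed_fixed_points by (auto simp: C_def)
  obtain \<kappa> \<delta>1 where k: "\<kappa> \<ge> 1" "\<delta>1 > 0"
    and kap: "\<And>a b. dist a w \<le> \<delta>1 \<Longrightarrow> P a = a \<Longrightarrow> b \<in> V \<Longrightarrow> infdist a C \<le> \<kappa> * dist a b"
    using subtransversal_atE[OF st] unfolding C_def by blast
  define \<epsilon> where "\<epsilon> = 1 / (4 * \<kappa>\<^sup>2)"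
  have e: "\<epsilon> > 0" using k by (simp add: \<epsilon>_def)
  obtain \<delta>2 where d2: "\<delta>2 > 0" and sr': "\<And>z b c. dist z w \<le> \<delta>2 \<Longrightarrow> b \<in> projector V z \<Longrightarrow> c \<in> V \<Longrightarrow>
    dist c w \<le> \<delta>2 \<Longrightarrow> (z - b) \<bullet> (c - b) \<le> \<epsilon> * (dist z c)\<^sup>2"
    using proximally_superregular_bound[OF sr e] by blast
  \<comment> \<open>The halving accounts for the nearest point of the intersection, which may lie twice as far from the base point.\<close>
  define \<delta> where "\<delta> = min \<delta>1 (\<delta>2 / 2)"
  have \<delta>: "\<delta> > 0" "\<delta> \<le> \<delta>1" "2 * \<delta> \<le> \<delta>2" using k d2 by (auto simp: \<delta>_def)
  have "1 \<le> \<kappa>\<^sup>2" using k by simp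
  then obtain \<rho> where \<rho>: "0 \<le> \<rho>" "\<rho> < 1" "\<rho>\<^sup>2 = 1 - 1 / (2 * \<kappa>\<^sup>2)"
    by (rule contraction_factor)
  have main: "dist (P b) a \<le> 1 * infdist a C \<and> infdist (P b) C \<le> \<rho> * infdist a C"
    if a: "dist a w \<le> \<delta>" "P a = a" and b: "b \<in> projector V a" for a b
  proof -
    obtain c where c: "c \<in> projector C a" using projector_nonempty[of C] C by blast
    then have g: "infdist a C = dist a c" and cC: "c \<in> C" by (auto simp: projector_def)
    then have cV: "c \<in> V" "P c = c" by (auto simp: C_def)
    have ab: "dist a b \<le> dist a c" using b cV by (auto simp: projector_iff)
    have 1: "dist (P b) a \<le> dist a c" using dist_le[of a b] a ab by (simp add: dist_commute)
    have "dist c w \<le> \<delta>2" using projector_dist_le[OF c C(2)] a \<delta> by simp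
    then have ip: "(a - b) \<bullet> (c - b) \<le> \<epsilon> * (dist a c)\<^sup>2" using sr'[OF _ b] cV a \<delta> by auto
    have "dist a c \<le> \<kappa> * dist a b" using kap[of a b] a \<delta> b g by (auto simp: projector_def)
    then have "(dist a c)\<^sup>2 \<le> (\<kappa> * dist a b)\<^sup>2" by (intro power_mono) auto
    then have lower: "(dist a c)\<^sup>2 / \<kappa>\<^sup>2 \<le> (dist a b)\<^sup>2"
      using k by (simp add: power_mult_distrib field_simps)
    have "(dist (P b) c)\<^sup>2 \<le> (dist b c)\<^sup>2" using dist_le[of c b] cV by (intro power_mono) auto
    also have "\<dots> = (dist a c)\<^sup>2 - (dist a b)\<^sup>2 + 2 * ((a - b) \<bullet> (c - b))"
      unfolding dist_norm power2_norm_eq_inner by (simp add: algebra_simps inner_commute)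
    also have "\<dots> \<le> (dist a c)\<^sup>2 - (dist a c)\<^sup>2 / \<kappa>\<^sup>2 + 2 * (\<epsilon> * (dist a c)\<^sup>2)"
      using lower ip by simp
    also have "\<dots> = (\<rho> * dist a c)\<^sup>2"
      using k by (simp add: \<rho> power_mult_distrib \<epsilon>_def field_simps)
    finally have "dist (P b) c \<le> \<rho> * dist a c" by (rule power2_le_imp_le) (use \<rho> in auto)
    then have "infdist (P b) C \<le> \<rho> * dist a c" using infdist_le[OF cC, of "P b"] by simp
    then show ?thesis using 1 g by simp
  qed
  define \<eta> where "\<eta> = \<delta> / (1 + 1 / (1 - \<rho>))"
  have "\<eta> / 2 > 0" unfolding \<eta>_def using \<delta> \<rho> by (intro divide_pos_pos add_pos_pos) auto
  moreover have "\<exists>l \<in> V \<inter> {x. P x = x}. R_linearly_converges x l"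
    if x: "dist (x 0) w \<le> \<eta> / 2" "\<And>n. x (Suc n) \<in> P ` projector V (x n)" for x
  proof -
    define y where "y n = x (Suc n)" for n
    have Py: "P (y n) = y n" for n using x(2)[of n] by (auto simp: y_def idem)
    have step: "dist (y (Suc n)) (y n) \<le> 1 * infdist (y n) C \<and>
        infdist (y (Suc n)) C \<le> \<rho> * infdist (y n) C" if "dist (y n) w \<le> \<delta>" for n
      using main[OF that Py] x(2)[of "Suc n"] by (auto simp: y_def)
    obtain b where b: "b \<in> projector V (x 0)" "x (Suc 0) = P b" using x(2)[of 0] by auto
    have "dist (y 0) w \<le> \<eta>"
      using dist_le[of w b] projector_dist_le[OF b(1) V(2)] V x b by (simp add: y_def)
    from contracting_infdist_R_linear_convergence[OF C \<rho>(1,2) _ step this[unfolded \<eta>_def]]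
    obtain l where "l \<in> C" "R_linearly_converges y l" by auto
    then show ?thesis using R_linearly_converges_Suc[of x l] unfolding y_def C_def by auto
  qed
  ultimately show ?thesis using that by blast
qed

text \<open>Split \<open>x = a + n\<close> with \<open>a = P x\<close> and \<open>P n = 0\<close>, so that the reflected point is \<open>z = a - n\<close>; let \<open>b\<close>
  be a nearest point of \<open>z\<close> in \<open>V\<close> and \<open>u = z - b\<close>. The step replaces \<open>x\<close> by \<open>a - u\<close> and has length
  \<open>\<parallel>a - b\<parallel> = \<parallel>u + n\<parallel>\<close>. For \<open>c\<close> in the intersection, \<open>n\<close> is orthogonal to \<open>a - c\<close>, which gives
  \<open>\<parallel>a - u - c\<parallel>\<^sup>2 = \<parallel>x - c\<parallel>\<^sup>2 - \<parallel>a - b\<parallel>\<^sup>2 + 2 u \<bullet> (c - b)\<close>. Superregularity makes the last term small.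
  For the middle one, \<open>P (a - b) = P u\<close> and transversality bound \<open>\<parallel>u\<parallel>\<close>, hence \<open>\<parallel>n\<parallel>\<close>, by a multiple
  of \<open>\<parallel>a - b\<parallel>\<close>, and subtransversality bounds the distance from \<open>a\<close> to the intersection.\<close>
lemma douglas_rachford_converges:
  assumes sr: "proximally_superregular_at V w" and tr: "transversal_at V w"
    and V: "closed V" "w \<in> V" "P w = w"
  obtains \<delta> where "\<delta> > 0" "\<And>x. dist (x 0) w \<le> \<delta> \<Longrightarrow>
    (\<And>n. x (Suc n) \<in> (\<lambda>b. x n - P (x n) + b) ` projector V (2 *\<^sub>R P (x n) - x n)) \<Longrightarrow>
    \<exists>l \<in> V \<inter> {x. P x = x}. R_linearly_converges x l"
proof -
  define C where "C = V \<inter> {x. P x = x}"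
  have C: "closed C" "w \<in> C" using V closed_fixed_points by (auto simp: C_def)
  obtain \<kappa> \<delta>1 where k: "\<kappa> \<ge> 1" "\<delta>1 > 0"
    and kap: "\<And>a b. dist a w \<le> \<delta>1 \<Longrightarrow> P a = a \<Longrightarrow> b \<in> V \<Longrightarrow> infdist a C \<le> \<kappa> * dist a b"
    using subtransversal_atE[OF transversal_imp_subtransversal[OF tr V]] unfolding C_def by blast
  obtain c0 \<delta>3 where c0: "c0 > 0" "\<delta>3 > 0"
    and tr': "\<And>z b. dist z w \<le> \<delta>3 \<Longrightarrow> b \<in> projector V z \<Longrightarrow> c0 * norm (z - b) \<le> norm (P (z - b))"
    using tr unfolding transversal_at_def by (auto simp: dist_commute)
  \<comment> \<open>The summands bound the squared components of the error inside the subspace and orthogonal to it, relative to the squared step length.\<close>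
  define \<Lambda> where "\<Lambda> = \<kappa>\<^sup>2 + (1 + 1 / c0)\<^sup>2"
  have L: "\<Lambda> \<ge> 1" using k by (simp add: \<Lambda>_def add_increasing2)
  define \<epsilon> where "\<epsilon> = 1 / (4 * \<Lambda>)"
  have e: "\<epsilon> > 0" using L by (simp add: \<epsilon>_def)
  obtain \<delta>2 where d2: "\<delta>2 > 0" and sr': "\<And>z b c. dist z w \<le> \<delta>2 \<Longrightarrow> b \<in> projector V z \<Longrightarrow> c \<in> V \<Longrightarrow>
    dist c w \<le> \<delta>2 \<Longrightarrow> (z - b) \<bullet> (c - b) \<le> \<epsilon> * (dist z c)\<^sup>2"
    using proximally_superregular_bound[OF sr e] by blast
  define \<delta> where "\<delta> = min (min \<delta>1 \<delta>3) (\<delta>2 / 2)"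
  have \<delta>: "\<delta> > 0" "\<delta> \<le> \<delta>1" "\<delta> \<le> \<delta>3" "2 * \<delta> \<le> \<delta>2" using k d2 c0 by (auto simp: \<delta>_def)
  obtain \<rho> where \<rho>: "0 \<le> \<rho>" "\<rho> < 1" "\<rho>\<^sup>2 = 1 - 1 / (2 * \<Lambda>)"
    using L by (rule contraction_factor)
  have main: "dist (x - P x + b) x \<le> 2 * infdist x C \<and> infdist (x - P x + b) C \<le> \<rho> * infdist x C"
    if x: "dist x w \<le> \<delta>" and b: "b \<in> projector V (2 *\<^sub>R P x - x)" for x b
  proof -
    define a where "a = P x"
    define z where "z = 2 *\<^sub>R a - x"
    define n where "n = x - a"
    define u where "u = z - b"
    have Pa: "P a = a" by (simp add: a_def idem)
    have Pn: "P n = 0" by (simp add: n_def diff Pa a_def idem)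
    have xan: "x = a + n" and zan: "z = a - n" and abu: "a - b = u + n" and bV: "b \<in> V"
      using b by (auto simp: n_def z_def u_def scaleR_2 projector_def)
    have bz: "b \<in> projector V z" using b by (simp add: z_def a_def)
    \<comment> \<open>The reflection preserves the distance to every point of the subspace.\<close>
    have zw: "dist z c = dist x c" if "P c = c" for c
      using reflection_dist[OF that, of x] by (simp add: z_def a_def)
    obtain c where c: "c \<in> projector C x" using projector_nonempty[of C] C by blast
    then have g: "infdist x C = dist x c" and cC: "c \<in> C" by (auto simp: projector_def)
    then have cV: "c \<in> V" "P c = c" by (auto simp: C_def)
    have orth: "(a - c) \<bullet> n = 0" if "P c = c" for c
    proof -
      have "P (a - c) = a - c" using that by (simp add: diff Pa)
      then show ?thesis using selfadjoint[of "a - c" n] Pn by simp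
    qed
    have "norm u \<le> dist z c" using bz cV by (auto simp: projector_iff u_def dist_norm)
    then have u: "norm u \<le> dist x c" using zw cV by simp
    have split: "(dist x c)\<^sup>2 = (dist a c)\<^sup>2 + (norm n)\<^sup>2" if "P c = c" for c
      using orth[OF that] unfolding xan dist_norm power2_norm_eq_inner
      by (simp add: algebra_simps inner_commute)
    have "(norm n)\<^sup>2 \<le> (dist x c)\<^sup>2" using split cV by simp
    then have n: "norm n \<le> dist x c" by (rule power2_le_imp_le) simp
    have "norm (a - b) \<le> norm u + norm n" unfolding abu by (rule norm_triangle_ineq)
    then have 1: "dist (x - a + b) x \<le> 2 * dist x c"
      using u n by (simp add: dist_norm norm_minus_commute)
    have lower: "(dist x c)\<^sup>2 \<le> \<Lambda> * (dist a b)\<^sup>2"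
    proof -
      \<comment> \<open>Subtransversality estimates the distance of the shadow, so the nearest point of the shadow enters and is then compared with that of the iterate.\<close>
      obtain c' where c': "c' \<in> projector C a" using projector_nonempty[of C] C by blast
      then have g': "infdist a C = dist a c'" and c'C: "c' \<in> C" by (auto simp: projector_def)
      have c'V: "P c' = c'" using c'C by (auto simp: C_def)
      have "dist a w \<le> \<delta>1" using dist_le[of w x] V x \<delta> by (simp add: a_def)
      then have "dist a c' \<le> \<kappa> * dist a b" using kap[OF _ Pa bV] g' by simp
      then have A: "(dist a c')\<^sup>2 \<le> \<kappa>\<^sup>2 * (dist a b)\<^sup>2"
        using power_mono[of "dist a c'" "\<kappa> * dist a b" 2] by (simp add: power_mult_distrib)
      have "P (a - b) = P u" unfolding abu by (simp add: linear_add[OF linear] Pn)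
      moreover have "c0 * norm u \<le> norm (P u)"
        unfolding u_def by (rule tr'[OF _ bz]) (use zw[of w] V x \<delta> in auto)
      ultimately have "c0 * norm u \<le> dist a b" using norm_le[of "a - b"] by (simp add: dist_norm)
      then have "norm u \<le> dist a b / c0" using c0 by (simp add: field_simps)
      moreover have "norm n \<le> dist a b + norm u"
        using norm_triangle_ineq4[of "a - b" u] abu by (simp add: dist_norm)
      ultimately have "norm n \<le> (1 + 1 / c0) * dist a b" by (simp add: algebra_simps)
      then have "(norm n)\<^sup>2 \<le> (1 + 1 / c0)\<^sup>2 * (dist a b)\<^sup>2"
        using power_mono[of "norm n" "(1 + 1 / c0) * dist a b" 2] by (simp add: power_mult_distrib)
      then have "(dist x c')\<^sup>2 \<le> \<Lambda> * (dist a b)\<^sup>2"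
        using A split[OF c'V] by (simp add: \<Lambda>_def algebra_simps)
      moreover have "(dist x c)\<^sup>2 \<le> (dist x c')\<^sup>2"
        using c c'C by (intro power_mono) (auto simp: projector_iff)
      ultimately show ?thesis by linarith
    qed
    have "dist c w \<le> \<delta>2" using projector_dist_le[OF c C(2)] x \<delta> by simp
    moreover have "dist z w \<le> \<delta>2" using zw[of w] V x \<delta> by simp
    ultimately have "u \<bullet> (c - b) \<le> \<epsilon> * (dist z c)\<^sup>2"
      unfolding u_def using sr'[OF _ bz cV(1)] by blast
    then have ip: "u \<bullet> (c - b) \<le> \<epsilon> * (dist x c)\<^sup>2" using zw[OF cV(2)] by simp
    have "(dist (x - a + b) c)\<^sup>2 = (dist x c)\<^sup>2 - (dist a b)\<^sup>2 + 2 * (u \<bullet> (c - b))"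
    proof -
      have i: "x - a + b - c = (a - c) - u" "c - b = n + u - (a - c)" "x - c = (a - c) + n"
        using abu xan by (auto simp: algebra_simps)
      show ?thesis using orth[OF cV(2)] unfolding dist_norm i abu power2_norm_eq_inner
        by (simp add: inner_add_left inner_add_right inner_diff_left inner_diff_right inner_commute)
    qed
    also have "\<dots> \<le> (dist x c)\<^sup>2 - (dist x c)\<^sup>2 / \<Lambda> + 2 * (\<epsilon> * (dist x c)\<^sup>2)"
    proof -
      have "(dist x c)\<^sup>2 / \<Lambda> \<le> (dist a b)\<^sup>2" using lower L by (simp add: divide_le_eq mult.commute)
      then show ?thesis using ip by linarith
    qed
    also have "\<dots> = (\<rho> * dist x c)\<^sup>2"
      using L by (simp add: \<rho> power_mult_distrib \<epsilon>_def field_simps)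
    finally have "dist (x - a + b) c \<le> \<rho> * dist x c" by (rule power2_le_imp_le) (use \<rho> in auto)
    then have "infdist (x - a + b) C \<le> \<rho> * dist x c" using infdist_le[OF cC, of "x - a + b"] by simp
    then show ?thesis using 1 g by (simp add: a_def)
  qed
  define \<eta> where "\<eta> = \<delta> / (1 + 2 / (1 - \<rho>))"
  have "\<eta> > 0" unfolding \<eta>_def using \<delta> \<rho> by (intro divide_pos_pos add_pos_pos) auto
  moreover have "\<exists>l \<in> V \<inter> {x. P x = x}. R_linearly_converges x l"
    if x: "dist (x 0) w \<le> \<eta>"
      "\<And>n. x (Suc n) \<in> (\<lambda>b. x n - P (x n) + b) ` projector V (2 *\<^sub>R P (x n) - x n)" for x
  proof -
    have step: "dist (x (Suc n)) (x n) \<le> 2 * infdist (x n) C \<and>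
        infdist (x (Suc n)) C \<le> \<rho> * infdist (x n) C" if "dist (x n) w \<le> \<delta>" for n
      using main[OF that] x(2)[of n] by auto
    from contracting_infdist_R_linear_convergence[OF C \<rho>(1,2) _ step x(1)[unfolded \<eta>_def]]
    show ?thesis unfolding C_def by (metis zero_le_numeral)
  qed
  ultimately show ?thesis using that by blast
qed

end

section \<open>The product space\<close>

abbreviation box_product :: "('n::finite \<Rightarrow> 'a set) \<Rightarrow> ('a ^ 'n) set" where
  "box_product L \<equiv> {x. \<forall>i. x $ i \<in> L i}"

lemma power2_dist_vec: "(dist x y)\<^sup>2 = (\<Sum>i\<in>UNIV. (dist (x $ i) (y $ i))\<^sup>2)"
  for x y :: "'a::real_inner ^ 'n::finite"
  by (simp add: dist_norm power2_norm_eq_inner inner_vec_def)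

text \<open>The squared distance is the sum over the coordinates, so it is minimal on a product exactly when
  each coordinate is. For the inclusion from left to right, compare with the point that differs in
  one coordinate only.\<close>
lemma projector_box_product:
  fixes x :: "'a::real_inner ^ 'n::finite"
  shows "projector (box_product L) x = {y. \<forall>i. y $ i \<in> projector (L i) (x $ i)}"
proof (intro set_eqI iffI CollectI allI)
  fix y assume "y \<in> {y. \<forall>i. y $ i \<in> projector (L i) (x $ i)}"
  then have y: "y $ i \<in> L i" "v \<in> L i \<Longrightarrow> dist (x $ i) (y $ i) \<le> dist (x $ i) v" for i v
    by (auto simp: projector_iff)
  have "dist x y \<le> dist x v" if "v \<in> box_product L" for v
  proof (rule power2_le_imp_le)
    show "(dist x y)\<^sup>2 \<le> (dist x v)\<^sup>2"
      unfolding power2_dist_vec using y that by (intro sum_mono power_mono) auto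
  qed simp
  then show "y \<in> projector (box_product L) x" using y by (auto simp: projector_iff)
next
  fix y i assume "y \<in> projector (box_product L) x"
  then have y: "y $ k \<in> L k" "v \<in> box_product L \<Longrightarrow> dist x y \<le> dist x v" for k v
    by (auto simp: projector_iff)
  have "dist (x $ i) (y $ i) \<le> dist (x $ i) v" if v: "v \<in> L i" for v
  proof -
    define y' where "y' = (\<chi> k. if k = i then v else y $ k)"
    have "dist x y \<le> dist x y'" by (rule y) (use y v in \<open>auto simp: y'_def\<close>)
    then have "(dist x y)\<^sup>2 \<le> (dist x y')\<^sup>2" by (intro power_mono) auto
    moreover have "(\<Sum>k\<in>UNIV-{i}. (dist (x $ k) (y $ k))\<^sup>2) = (\<Sum>k\<in>UNIV-{i}. (dist (x $ k) (y' $ k))\<^sup>2)"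
      by (intro sum.cong) (auto simp: y'_def)
    moreover have split: "(dist x q)\<^sup>2 = (dist (x $ i) (q $ i))\<^sup>2 + (\<Sum>k\<in>UNIV-{i}. (dist (x $ k) (q $ k))\<^sup>2)" for q
      unfolding power2_dist_vec by (rule sum.remove) auto
    ultimately have "(dist (x $ i) (y $ i))\<^sup>2 \<le> (dist (x $ i) (y' $ i))\<^sup>2"
      using split[of y] split[of y'] by linarith
    then have "(dist (x $ i) (y $ i))\<^sup>2 \<le> (dist (x $ i) v)\<^sup>2" by (simp add: y'_def)
    then show ?thesis by (rule power2_le_imp_le) auto
  qed
  then show "y $ i \<in> projector (L i) (x $ i)" using y by (auto simp: projector_iff)
qed

lemma closed_box_product:
  fixes L :: "'n::finite \<Rightarrow> 'a::real_inner set"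
  assumes "\<And>i. closed (L i)"
  shows "closed (box_product L)"
proof -
  have "box_product L = (\<Inter>i. (\<lambda>x. x $ i) -` L i)" by auto
  then show ?thesis using assms by (auto intro!: closed_INT closed_vimage continuous_intros)
qed

text \<open>Halving the radius suffices, because a nearest point is at most twice as far from \<open>x\<close> as the point
  that is projected.\<close>
lemma superregular_imp_proximally_superregular:
  fixes C :: "'a::euclidean_space set"
  assumes "superregular_at C x" "x \<in> C"
  shows "proximally_superregular_at C x"
  unfolding proximally_superregular_at_def
proof (intro allI impI)
  fix \<epsilon> :: real assume "\<epsilon> > 0"
  then obtain \<delta> where d: "\<delta> > 0" "\<forall>y \<in> C \<inter> cball x \<delta>. \<forall>z \<in> C \<inter> cball x \<delta>. \<forall>u \<in> limiting_normal_cone C z.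
        u \<bullet> (y - z) \<le> \<epsilon> * norm u * norm (y - z)"
    using assms unfolding superregular_at_def by meson
  have "(z - b) \<bullet> (c - b) \<le> \<epsilon> * norm (z - b) * norm (c - b)"
    if h: "z \<in> cball x (\<delta>/2)" "b \<in> projector C z" "c \<in> C \<inter> cball x (\<delta>/2)" for z b c
  proof -
    have "dist x b \<le> \<delta>" using projector_dist_le[OF h(2) assms(2)] h(1) by (simp add: dist_commute)
    then have "b \<in> C \<inter> cball x \<delta>" "c \<in> C \<inter> cball x \<delta>" using h d by (auto simp: projector_iff)
    then show ?thesis using d proximal_normal_in_limiting_normal_cone[OF h(2)] by blast
  qed
  then show "\<exists>\<delta>>0. \<forall>z\<in>cball x \<delta>. \<forall>b\<in>projector C z. \<forall>c\<in>C \<inter> cball x \<delta>.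
      (z - b) \<bullet> (c - b) \<le> \<epsilon> * norm (z - b) * norm (c - b)"
    using d by (intro exI[of _ "\<delta>/2"]) auto
qed

text \<open>Summing the coordinate inequalities gives
  \<open>\<epsilon> (\<Sum>i. \<parallel>z\<^sub>i - b\<^sub>i\<parallel> \<parallel>c\<^sub>i - b\<^sub>i\<parallel>)\<close>, which the Cauchy--Schwarz inequality bounds by \<open>\<epsilon> \<parallel>z - b\<parallel> \<parallel>c - b\<parallel>\<close>.\<close>
lemma proximally_superregular_box_product:
  fixes L :: "'n::finite \<Rightarrow> 'a::euclidean_space set"
  assumes "\<And>i. proximally_superregular_at (L i) (x $ i)"
  shows "proximally_superregular_at (box_product L) x"
  unfolding proximally_superregular_at_def
proof (intro allI impI)
  fix \<epsilon> :: real assume e: "\<epsilon> > 0"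
  have "\<forall>i. \<exists>\<delta>>0. \<forall>z\<in>cball (x $ i) \<delta>. \<forall>b\<in>projector (L i) z.
     \<forall>c\<in>L i \<inter> cball (x $ i) \<delta>. (z - b) \<bullet> (c - b) \<le> \<epsilon> * norm (z - b) * norm (c - b)"
    using assms e unfolding proximally_superregular_at_def by meson
  then obtain \<delta> where d: "\<And>i. \<delta> i > 0" "\<And>i. \<forall>z\<in>cball (x $ i) (\<delta> i). \<forall>b\<in>projector (L i) z.
     \<forall>c\<in>L i \<inter> cball (x $ i) (\<delta> i). (z - b) \<bullet> (c - b) \<le> \<epsilon> * norm (z - b) * norm (c - b)"
    by metis
  define \<eta> where "\<eta> = Min (range \<delta>)"
  have \<eta>: "\<eta> > 0" "\<eta> \<le> \<delta> i" for i using d by (auto simp: \<eta>_def)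
  have "(z - b) \<bullet> (c - b) \<le> \<epsilon> * norm (z - b) * norm (c - b)"
    if h: "z \<in> cball x \<eta>" "b \<in> projector (box_product L) z" "c \<in> box_product L \<inter> cball x \<eta>" for z b c
  proof -
    have "(z $ i - b $ i) \<bullet> (c $ i - b $ i) \<le> \<epsilon> * norm (z $ i - b $ i) * norm (c $ i - b $ i)" for i
    proof -
      have "dist (x $ i) (z $ i) \<le> \<delta> i" "dist (x $ i) (c $ i) \<le> \<delta> i"
        using h \<eta>(2)[of i] dist_vec_nth_le[of x i z] dist_vec_nth_le[of x i c] by auto
      moreover have "b $ i \<in> projector (L i) (z $ i)" "c $ i \<in> L i"
        using h unfolding projector_box_product by auto
      ultimately show ?thesis using d(2)[of i] by auto
    qed
    then have "(z - b) \<bullet> (c - b) \<le> (\<Sum>i\<in>UNIV. \<epsilon> * norm (z $ i - b $ i) * norm (c $ i - b $ i))"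
      unfolding inner_vec_def by (intro sum_mono) simp
    also have "\<dots> = \<epsilon> * (\<Sum>i\<in>UNIV. \<bar>norm ((z - b) $ i)\<bar> * \<bar>norm ((c - b) $ i)\<bar>)"
      by (simp add: sum_distrib_left mult.assoc)
    also have "\<dots> \<le> \<epsilon> * (norm (z - b) * norm (c - b))"
      unfolding norm_vec_def using e by (intro mult_left_mono L2_set_mult_ineq) auto
    finally show ?thesis by (simp add: mult.assoc)
  qed
  then show "\<exists>\<delta>>0. \<forall>z\<in>cball x \<delta>. \<forall>b\<in>projector (box_product L) z.
     \<forall>c\<in>box_product L \<inter> cball x \<delta>. (z - b) \<bullet> (c - b) \<le> \<epsilon> * norm (z - b) * norm (c - b)"
    using \<eta>(1) by (intro exI[of _ \<eta>] conjI ballI)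
qed

lemma P_W_nth: "P_W x $ i = (1 / real CARD('n)) *\<^sub>R (\<Sum>j\<in>UNIV. x $ j)"
  for x :: "'a::euclidean_space ^ 'n::finite"
  by (simp add: P_W_def)

lemma orthogonal_projector_P_W:
  "orthogonal_projector (P_W :: 'a::euclidean_space ^ 'n::finite \<Rightarrow> 'a ^ 'n)"
proof (rule orthogonal_projector.intro)
  show "linear (P_W :: 'a ^ 'n \<Rightarrow> 'a ^ 'n)"
    by (rule linearI) (auto simp: vec_eq_iff P_W_nth sum.distrib scaleR_sum_right algebra_simps)
  show "P_W (P_W x) = P_W x" for x :: "'a ^ 'n"
    by (simp add: vec_eq_iff P_W_nth sum_constant_scaleR)
  show "P_W x \<bullet> y = x \<bullet> P_W y" for x y :: "'a ^ 'n"
    by (simp add: inner_vec_def P_W_nth sum_divide_distrib[symmetric] inner_sum_left[symmetric]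
        inner_sum_right[symmetric])
qed

interpretation P_W: orthogonal_projector P_W
  by (rule orthogonal_projector_P_W)

lemma P_W_const: "P_W (\<chi> i. a) = (\<chi> i. a)"
  by (simp add: vec_eq_iff P_W_nth sum_constant_scaleR)

lemma P_W_fixedE:
  assumes "P_W x = x"
  obtains a where "x = (\<chi> i. a)"
  using assms by (metis P_W_def)

lemma linearly_regular_around_reindex:
  assumes "bij_betw f I J" "linearly_regular_around J L x"
  shows "linearly_regular_around I (\<lambda>i. L (f i)) x"
proof -
  have "J = f ` I" using assms by (simp add: bij_betw_def)
  then show ?thesis using assms(2) unfolding linearly_regular_around_def by (simp add: image_image)
qed

lemma strongly_regular_at_reindex:
  assumes "bij_betw f I J" "strongly_regular_at J L x"
  shows "strongly_regular_at I (\<lambda>i. L (f i)) x"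
  unfolding strongly_regular_at_def
proof (intro allI impI, elim conjE)
  fix u assume u: "\<forall>i\<in>I. u i \<in> limiting_normal_cone (L (f i)) x" "(\<Sum>i\<in>I. u i) = 0"
  define v where "v = u \<circ> the_inv_into I f"
  have v: "v (f i) = u i" if "i \<in> I" for i
    using that assms(1) by (simp add: v_def bij_betw_def the_inv_into_f_f)
  have "(\<Sum>j\<in>J. v j) = (\<Sum>i\<in>I. v (f i))" using assms(1) by (simp add: sum.reindex_bij_betw)
  also have "\<dots> = 0" using u v by simp
  finally have "(\<Sum>j\<in>J. v j) = 0" .
  moreover have "\<forall>j\<in>J. v j \<in> limiting_normal_cone (L j) x"
    using assms(1) u v by (auto simp: bij_betw_def)
  ultimately have "\<forall>j\<in>J. v j = 0" using assms(2) unfolding strongly_regular_at_def by blast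
  then show "\<forall>i\<in>I. u i = 0" using v assms(1) by (auto simp: bij_betw_def)
qed

text \<open>A diagonal point \<open>(\<alpha>, \<dots>, \<alpha>)\<close> is within \<open>m \<parallel>\<alpha> - c\<parallel>\<close> of \<open>(c, \<dots>, c)\<close>, where \<open>m\<close> is the number of
  coordinates, and its distance to any point of the product dominates the distance from \<open>\<alpha>\<close> to each
  factor.\<close>
lemma linearly_regular_imp_subtransversal:
  fixes L :: "'n::finite \<Rightarrow> 'a::euclidean_space set"
  assumes lr: "linearly_regular_around UNIV L x" and L: "\<And>i. closed (L i)" "\<And>i. x \<in> L i"
  shows "P_W.subtransversal_at (box_product L) (\<chi> i. x)"
proof -
  define C where "C = box_product L \<inter> {x. P_W x = x}"
  obtain \<kappa> \<delta> where k: "\<kappa> \<ge> 0" "\<delta> > 0" and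
    reg: "\<And>z. dist z x \<le> \<delta> \<Longrightarrow> infdist z (\<Inter>i. L i) \<le> \<kappa> * Max ((\<lambda>i. infdist z (L i)) ` UNIV)"
    using lr unfolding linearly_regular_around_def by (auto simp: dist_commute)
  define m where "m = real CARD('n)"
  have m: "m > 0" by (simp add: m_def)
  have "infdist a C \<le> (m * \<kappa> + 1) * dist a b"
    if a: "dist a (\<chi> i. x) \<le> \<delta>" "P_W a = a" and b: "b \<in> box_product L" for a b
  proof -
    obtain \<alpha> where \<alpha>: "a = (\<chi> i. \<alpha>)" using P_W_fixedE a by blast
    have "dist \<alpha> x \<le> \<delta>" using dist_vec_nth_le[of a undefined "\<chi> i. x"] a \<alpha> by simp
    note reg = reg[OF this]
    have "x \<in> (\<Inter>i. L i)" "closed (\<Inter>i. L i)" using L by auto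
    then obtain c where c: "c \<in> (\<Inter>i. L i)" "infdist \<alpha> (\<Inter>i. L i) = dist \<alpha> c"
      using infdist_attains_inf[of "\<Inter>i. L i" \<alpha>] by blast
    have "infdist \<alpha> (L i) \<le> dist a b" for i
    proof -
      have "infdist \<alpha> (L i) \<le> dist \<alpha> (b $ i)" using b by (intro infdist_le) auto
      also have "\<dots> \<le> dist a b" using dist_vec_nth_le[of a i b] \<alpha> by simp
      finally show ?thesis .
    qed
    then have "Max ((\<lambda>i. infdist \<alpha> (L i)) ` UNIV) \<le> dist a b" by simp
    from mult_left_mono[OF this k(1)] have "dist \<alpha> c \<le> \<kappa> * dist a b"
      using reg c(2) by linarith
    then have "m * dist \<alpha> c \<le> m * (\<kappa> * dist a b)" using m by (intro mult_left_mono) auto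
    moreover have "dist a (\<chi> i. c) \<le> m * dist \<alpha> c"
      using L2_set_le_sum[of UNIV "\<lambda>i. dist (a $ i) c"] \<alpha> by (simp add: dist_vec_def m_def)
    moreover have "infdist a C \<le> dist a (\<chi> i. c)"
      using c by (intro infdist_le) (auto simp: C_def P_W_const)
    ultimately have "infdist a C \<le> m * (\<kappa> * dist a b)" by linarith
    also have "\<dots> \<le> (m * \<kappa> + 1) * dist a b" by (simp add: algebra_simps)
    finally show ?thesis .
  qed
  \<comment> \<open>Adding 1 makes the constant positive even if \<open>\<kappa> = 0\<close>.\<close>
  moreover have "m * \<kappa> + 1 > 0" using k(1) m by (simp add: add_nonneg_pos)
  ultimately show ?thesis unfolding P_W.subtransversal_at_def C_def[symmetric]
    by (intro exI[of _ "m * \<kappa> + 1"] exI[of _ \<delta>] conjI ballI impI k(2)) (simp_all add: dist_commute)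
qed

text \<open>Otherwise there are normalized proximal normals \<open>u n\<close> of the product, at points tending to the
  diagonal point, with \<open>P_W (u n)\<close> tending to \<open>0\<close>. A limit \<open>l\<close> of a subsequence is a unit vector
  whose coordinates are limiting normals of the factors, and they sum to \<open>0\<close> because \<open>P_W l = 0\<close>. This
  contradicts strong regularity.\<close>
lemma strongly_regular_imp_transversal:
  fixes L :: "'n::finite \<Rightarrow> 'a::euclidean_space set"
  assumes sr: "strongly_regular_at UNIV L x"
  shows "P_W.transversal_at (box_product L) (\<chi> i. x)"
proof (rule ccontr)
  assume "\<not> ?thesis"
  then have bad: "\<exists>z\<in>cball (\<chi> i. x) e. \<exists>b\<in>projector (box_product L) z. norm (P_W (z - b)) < e * norm (z - b)"
    if "e > 0" for e
    using that unfolding P_W.transversal_at_def by (meson not_le)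
  define Q where "Q n z b \<longleftrightarrow> z \<in> cball (\<chi> i. x) (inverse (real (Suc n))) \<and>
    b \<in> projector (box_product L) z \<and> norm (P_W (z - b)) < inverse (real (Suc n)) * norm (z - b)"
    for n z b
  have "\<forall>n. \<exists>z b. Q n z b"
  proof
    fix n
    show "\<exists>z b. Q n z b" using bad[of "inverse (real (Suc n))"] by (auto simp: Q_def)
  qed
  then obtain z b where Q: "\<And>n. Q n (z n) (b n)" by metis
  then have z: "dist (\<chi> i. x) (z n) \<le> inverse (real (Suc n))"
    and b: "b n \<in> projector (box_product L) (z n)"
    and P: "norm (P_W (z n - b n)) < inverse (real (Suc n)) * norm (z n - b n)" for n
    by (simp_all only: Q_def mem_cball)
  have nz: "norm (z n - b n) > 0" for n
  proof (rule ccontr)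
    assume "\<not> ?thesis"
    then have "z n - b n = 0" by simp
    then show False using P[of n] by simp
  qed
  define t where "t n = inverse (norm (z n - b n))" for n
  define u where "u n = t n *\<^sub>R (z n - b n)" for n
  have t: "t n > 0" for n using nz[of n] by (simp add: t_def)
  have "u n \<in> sphere 0 1" for n using nz[of n] by (simp add: u_def t_def)
  then obtain l s where l: "l \<in> sphere 0 1" and s: "strict_mono s" "(u \<circ> s) \<longlonglongrightarrow> l"
    using compact_sphere[of 0 1, unfolded compact_def] by metis
  have inv: "(\<lambda>n. inverse (real (Suc n))) \<longlonglongrightarrow> 0" by (rule LIMSEQ_inverse_real_of_nat)
  have Pu: "norm (P_W (u n)) \<le> inverse (real (Suc n))" for n
  proof -
    have "norm (P_W (u n)) = t n * norm (P_W (z n - b n))"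
      using t[of n] by (simp add: u_def linear_scale[OF P_W.linear])
    also have "\<dots> \<le> t n * (inverse (real (Suc n)) * norm (z n - b n))"
      using P[of n] t[of n] by (intro mult_left_mono) auto
    also have "\<dots> = inverse (real (Suc n))" using nz[of n] by (simp add: t_def)
    finally show ?thesis .
  qed
  have "(\<lambda>n. P_W (u n)) \<longlonglongrightarrow> 0"
    by (rule Lim_null_comparison[OF _ inv]) (use Pu in auto)
  then have "(\<lambda>n. P_W ((u \<circ> s) n)) \<longlonglongrightarrow> 0"
    using LIMSEQ_subseq_LIMSEQ[OF _ s(1)] by (force simp: o_def)
  moreover have "(\<lambda>n. P_W ((u \<circ> s) n)) \<longlonglongrightarrow> P_W l"
    using bounded_linear.tendsto[OF _ s(2)] P_W.linear linear_conv_bounded_linear by blast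
  ultimately have "P_W l = 0" using LIMSEQ_unique by blast
  then have "(1 / real CARD('n)) *\<^sub>R (\<Sum>j\<in>UNIV. l $ j) = 0" by (metis P_W_nth zero_index)
  then have sum0: "(\<Sum>j\<in>UNIV. l $ j) = 0" by simp
  have "(\<lambda>n. z n - (\<chi> i. x)) \<longlonglongrightarrow> 0"
    by (rule Lim_null_comparison[OF _ inv]) (use z in \<open>auto simp: dist_norm norm_minus_commute\<close>)
  then have "z \<longlonglongrightarrow> (\<chi> i. x)" by (simp add: LIM_zero_iff)
  then have zs: "(\<lambda>n. z (s n)) \<longlonglongrightarrow> (\<chi> i. x)"
    using LIMSEQ_subseq_LIMSEQ[OF _ s(1)] by (force simp: o_def)
  have "l $ i \<in> limiting_normal_cone (L i) x" for i
    unfolding limiting_normal_cone_def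
  proof (intro CollectI exI conjI allI)
    show "0 \<le> t (s n)" for n using t[of "s n"] by simp
    show "(\<lambda>n. z (s n) $ i) \<longlonglongrightarrow> x" using tendsto_vec_nth[OF zs, of i] by simp
    show "b (s n) $ i \<in> projector (L i) (z (s n) $ i)" for n
      using b[of "s n"] unfolding projector_box_product by auto
    show "(\<lambda>n. t (s n) *\<^sub>R (z (s n) $ i - b (s n) $ i)) \<longlonglongrightarrow> l $ i"
      using tendsto_vec_nth[OF s(2), of i] by (simp add: u_def)
  qed
  then have "\<forall>i. l $ i = 0" using sr sum0 unfolding strongly_regular_at_def by auto
  then have "l = 0" by (simp add: vec_eq_iff)
  then show False using l by simp
qed

section \<open>The constraint-reduced operators\<close>

lemma Q_V_subset_projector:
  fixes K :: "nat \<Rightarrow> 'a::euclidean_space set"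
  assumes "closed (K r)" "affine (K r)" "projector_image (K (r - 1)) (K r) \<subseteq> K r"
  shows "Q_V idx r K x \<subseteq> projector (reduced_product idx r K) x"
  unfolding reduced_product_def projector_box_product Q_V_def
proof (intro Collect_mono impI allI)
  fix y i
  assume "\<forall>i. y $ i \<in> (if idx i = r - 1 then projector_image (K (r - 1)) (projector (K r) (x $ i))
    else projector (K (idx i)) (x $ i))"
  from this[rule_format, of i] show "y $ i \<in> projector (reduced_family r K (idx i)) (x $ i)"
    using projector_affine_inter_subset[OF assms, of "x $ i"]
    by (auto simp: reduced_family_def split: if_splits)
qed

theorem theorem3p12:
  fixes r :: nat
    and K :: "nat \<Rightarrow> 'a::euclidean_space set"
    and idx :: "'n::finite \<Rightarrow> nat"
    and xbar :: 'a
  assumes "r \<ge> 2"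
    and "bij_betw idx UNIV {1..r - 1}"
    and "\<forall>j\<in>{1..r - 1}. closed (K j)"
    and "closed (K r)" and "affine (K r)"
    and "(\<Inter>j\<in>{1..r}. K j) \<noteq> {}"
    and "projector_image (K (r - 1)) (K r) \<subseteq> K r"
    and "xbar \<in> (\<Inter>j\<in>{1..r}. K j)"
    and "\<forall>j\<in>{1..r - 2}. superregular_at (K j) xbar"
    and "superregular_at (K (r - 1) \<inter> K r) xbar"
  shows "(linearly_regular_around {1..r - 1} (reduced_family r K) xbar \<longrightarrow>
           (\<exists>\<delta>>0. \<forall>x :: nat \<Rightarrow> 'a ^ 'n.
              x 0 \<in> cball (\<chi> i. xbar) \<delta> \<and> (\<forall>n. x (Suc n) \<in> MAP_op idx r K (x n)) \<longrightarrow>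
              (\<exists>xstar. (\<chi> i. xstar) \<in> reduced_product idx r K \<inter> diagonal \<and>
                 xstar \<in> (\<Inter>j\<in>{1..r}. K j) \<and>
                 R_linearly_converges x (\<chi> i. xstar))))
       \<and> (strongly_regular_at {1..r - 1} (reduced_family r K) xbar \<longrightarrow>
           (\<exists>\<delta>>0. \<forall>x :: nat \<Rightarrow> 'a ^ 'n.
              x 0 \<in> cball (\<chi> i. xbar) \<delta> \<and> (\<forall>n. x (Suc n) \<in> DR_op idx r K (x n)) \<longrightarrow>
              (\<exists>xstar. (\<chi> i. xstar) \<in> reduced_product idx r K \<inter> diagonal \<and>
                 xstar \<in> (\<Inter>j\<in>{1..r}. K j) \<and>
                 R_linearly_converges x (\<chi> i. xstar))))"
proof -
  define L where "L i = reduced_family r K (idx i)" for i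
  define V where "V = reduced_product idx r K"
  have VL: "V = box_product L" by (simp add: V_def L_def reduced_product_def)
  note bij = assms(2)
  have idx: "idx i \<in> {1..r - 1}" for i using bij by (auto simp: bij_betw_def)
  have closedL: "closed (L i)" for i
    using assms(3,4) idx[of i] assms(1) by (auto simp: L_def reduced_family_def intro!: closed_Int)
  have xL: "xbar \<in> L i" for i
    using assms(8) idx[of i] assms(1) by (auto simp: L_def reduced_family_def)
  have superL: "superregular_at (L i) xbar" for i
  proof (cases "idx i = r - 1")
    case False
    then have "idx i \<in> {1..r - 2}" using idx[of i] by auto
    then show ?thesis using False assms(9) by (simp add: L_def reduced_family_def)
  qed (use assms(10) in \<open>simp add: L_def reduced_family_def\<close>)
  let ?w = "(\<chi> i. xbar) :: 'a ^ 'n"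
  have closedV: "closed V" unfolding VL using closedL by (rule closed_box_product)
  have wV: "?w \<in> V" using xL by (simp add: VL)
  have sr: "proximally_superregular_at V ?w" unfolding VL
    using superL xL by (intro proximally_superregular_box_product)
      (simp add: superregular_imp_proximally_superregular)
  have QV: "Q_V idx r K x \<subseteq> projector V x" for x
    unfolding V_def using assms(4,5,7) by (rule Q_V_subset_projector)
  have limit: "\<exists>xstar. (\<chi> i. xstar) \<in> reduced_product idx r K \<inter> diagonal \<and>
      xstar \<in> (\<Inter>j\<in>{1..r}. K j) \<and> R_linearly_converges x (\<chi> i. xstar)"
    if "\<exists>l \<in> V \<inter> {x. P_W x = x}. R_linearly_converges x l" for x :: "nat \<Rightarrow> 'a ^ 'n"
  proof -
    obtain l where l: "l \<in> V" "P_W l = l" "R_linearly_converges x l" using \<open>\<exists>l\<in>_. _\<close> by auto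
    obtain a where a: "l = (\<chi> i. a)" using P_W_fixedE l(2) by blast
    have red: "a \<in> reduced_family r K j" if j: "j \<in> {1..r - 1}" for j
    proof -
      obtain i where "j = idx i" using j bij unfolding bij_betw_def by blast
      then show ?thesis using l(1) a unfolding VL L_def by simp
    qed
    have "a \<in> K j" if j: "j \<in> {1..r}" for j
    proof (cases "j < r - 1")
      case True
      then show ?thesis using red[of j] j by (simp add: reduced_family_def)
    next
      case False
      then have "j = r - 1 \<or> j = r" using j by auto
      then show ?thesis using red[of "r - 1"] assms(1) by (auto simp: reduced_family_def)
    qed
    then show ?thesis using l a by (intro exI[of _ a]) (auto simp: V_def diagonal_def)
  qed
  show ?thesis
  proof (intro conjI impI)
    assume "linearly_regular_around {1..r - 1} (reduced_family r K) xbar"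
    then have "linearly_regular_around UNIV L xbar"
      unfolding L_def by (rule linearly_regular_around_reindex[OF bij])
    then have "P_W.subtransversal_at V ?w" unfolding VL
      using closedL xL by (rule linearly_regular_imp_subtransversal)
    from P_W.alternating_projections_converge[OF sr this closedV wV P_W_const]
    obtain \<delta> where \<delta>: "\<delta> > 0" "\<And>x. dist (x 0) ?w \<le> \<delta> \<Longrightarrow>
      (\<And>n. x (Suc n) \<in> P_W ` projector V (x n)) \<Longrightarrow>
      \<exists>l \<in> V \<inter> {x. P_W x = x}. R_linearly_converges x l" by blast
    show "\<exists>\<delta>>0. \<forall>x :: nat \<Rightarrow> 'a ^ 'n.
        x 0 \<in> cball (\<chi> i. xbar) \<delta> \<and> (\<forall>n. x (Suc n) \<in> MAP_op idx r K (x n)) \<longrightarrow>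
        (\<exists>xstar. (\<chi> i. xstar) \<in> reduced_product idx r K \<inter> diagonal \<and>
           xstar \<in> (\<Inter>j\<in>{1..r}. K j) \<and> R_linearly_converges x (\<chi> i. xstar))"
    proof (intro exI[of _ \<delta>] conjI allI impI limit \<delta>)
      fix x :: "nat \<Rightarrow> 'a ^ 'n" and n
      assume x: "x 0 \<in> cball (\<chi> i. xbar) \<delta> \<and> (\<forall>n. x (Suc n) \<in> MAP_op idx r K (x n))"
      then show "dist (x 0) ?w \<le> \<delta>" by (simp add: dist_commute)
      show "x (Suc n) \<in> P_W ` projector V (x n)"
        using x QV[of "x n"] unfolding MAP_op_def by blast
    qed
  next
    assume "strongly_regular_at {1..r - 1} (reduced_family r K) xbar"
    then have "strongly_regular_at UNIV L xbar"
      unfolding L_def by (rule strongly_regular_at_reindex[OF bij])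
    then have "P_W.transversal_at V ?w" unfolding VL by (rule strongly_regular_imp_transversal)
    from P_W.douglas_rachford_converges[OF sr this closedV wV P_W_const]
    obtain \<delta> where \<delta>: "\<delta> > 0" "\<And>x. dist (x 0) ?w \<le> \<delta> \<Longrightarrow>
      (\<And>n. x (Suc n) \<in> (\<lambda>b. x n - P_W (x n) + b) ` projector V (2 *\<^sub>R P_W (x n) - x n)) \<Longrightarrow>
      \<exists>l \<in> V \<inter> {x. P_W x = x}. R_linearly_converges x l" by blast
    show "\<exists>\<delta>>0. \<forall>x :: nat \<Rightarrow> 'a ^ 'n.
        x 0 \<in> cball (\<chi> i. xbar) \<delta> \<and> (\<forall>n. x (Suc n) \<in> DR_op idx r K (x n)) \<longrightarrow>
        (\<exists>xstar. (\<chi> i. xstar) \<in> reduced_product idx r K \<inter> diagonal \<and>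
           xstar \<in> (\<Inter>j\<in>{1..r}. K j) \<and> R_linearly_converges x (\<chi> i. xstar))"
    proof (intro exI[of _ \<delta>] conjI allI impI limit \<delta>)
      fix x :: "nat \<Rightarrow> 'a ^ 'n" and n
      assume x: "x 0 \<in> cball (\<chi> i. xbar) \<delta> \<and> (\<forall>n. x (Suc n) \<in> DR_op idx r K (x n))"
      then show "dist (x 0) ?w \<le> \<delta>" by (simp add: dist_commute)
      show "x (Suc n) \<in> (\<lambda>b. x n - P_W (x n) + b) ` projector V (2 *\<^sub>R P_W (x n) - x n)"
        using x QV[of "R_W (x n)"] unfolding DR_op_def R_W_def by blast
    qed
  qed
qed

end
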